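(* Let $L$ be a finite semidistrim lattice and $x\in L$. Then $\mathsf{Row}_L(x)=\bigwedge\kappa_L(\mathcal{D}_L(x))$, $\mathsf{Row}_L^{-1}(x)=\bigvee\mathcal{U}_L(x)$, $\mathsf{Pop}^\downarrow_L(x)=x\wedge\bigwedge\kappa_L(\mathcal{D}_L(x))$, and $\mathsf{Pop}^\uparrow_L(x)=x\vee\bigvee\mathcal{U}_L(x)$. In particular, $\mathsf{Pop}^\downarrow_L(x)=x\wedge\mathsf{Row}_L(x)$ and $\mathsf{Pop}^\uparrow_L(x)=x\vee\mathsf{Row}_L^{-1}(x)$.
   Context: All lattices are finite. For a lattice $L$, $\mathcal{J}_L$ (resp. $\mathcal{M}_L$) is the set of join-irreducible (resp. meet-irreducible) elements; for $j\in\mathcal{J}_L$, $j_*$ is the unique element covered by $j$, and for $m\in\mathcal{M}_L$, $m^*$ is the unique element covering $m$. Let $\mathcal{M}_L(j)=\max\{z\in L: j_*=j\wedge z\}$ and $\mathcal{J}_L(m)=\min\{z\in L: m^*=m\vee z\}$. A pairing on $L$ is a bijection $\kappa:\mathcal{J}_L\to\mathcal{M}_L$ with $\kappa(j)\in\mathcal{M}_L(j)$ for all $j$ and $\kappa^{-1}(m)\in\mathcal{J}_L(m)$ for all $m$; $L$ is uniquely paired if it has exactly one pairing, denoted $\kappa_L$. A prime pair is a pair $(j_0,m_0)$ with $L=[\hat0,m_0]\sqcup[j_0,\hat1]$. A uniquely paired lattice $L$ is compatibly dismantlable if $|L|=1$ or there is a prime pair $(j_0,m_0)$ such that: (i) $[j_0,\hat1]$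 is compatibly dismantlable and $\alpha(j)=j_0\vee j$ defines a bijection $\{j\in\mathcal{J}_L: j_0\le\kappa_L(j)\}\to\mathcal{J}_{[j_0,\hat1]}$ with $\kappa_{[j_0,\hat1]}(\alpha(j))=\kappa_L(j)$; (ii) $[\hat0,m_0]$ is compatibly dismantlable and $\beta(m)=m_0\wedge m$ defines a bijection $\{m\in\mathcal{M}_L:\kappa_L^{-1}(m)\le m_0\}\to\mathcal{M}_{[\hat0,m_0]}$ with $\kappa_{[\hat0,m_0]}^{-1}(\beta(m))=\kappa_L^{-1}(m)$. The Galois graph $G_L$ is the directed graph on $\mathcal{J}_L$ with an edge $j\to j'$ iff $j\ne j'$ and $j\not\le\kappa_L(j')$. For $x\in L$ let $J_L(x)=\{j\in\mathcal{J}_L:j\le x\}$ and $M_L(x)=\{j\in\mathcal{J}_L:\kappa_L(j)\ge x\}$. For a compatibly dismantlable $L$, for every cover $x\lessdot y$ the set $M_L(x)\cap J_L(y)$ has exactly one element $j_{xy}$; set $\mathcal{D}_L(x)=\{j_{yx}:y\lessdot x\}$ and $\mathcal{U}_L(x)=\{j_{xy}:x\lessdot y\}$. $L$ is semidistrim if it is compatibly dismantlable and $\mathcal{D}_L(x)$, $\mathcal{U}_L(x)$ are independent sets (no two elements adjacent) of $G_L$ for all $x\in L$. For semidistrim $L$, the maps $\mathcal{D}_L$ and $\mathcal{U}_L$ are bijections from $L$ to the set of independent sets of $G_L$, and rowmotion $\mathsf{Row}_L:L\to L$ is the bijection defined by $\mathcal{U}_L(\mathsf{Row}_L(x))=\mathcal{D}_L(x)$.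 For any lattice, $\mathsf{Pop}^\downarrow_L(x)=x\wedge\bigwedge\{y:y\lessdot x\}$ and $\mathsf{Pop}^\uparrow_L(x)=x\vee\bigvee\{y:x\lessdot y\}$. For a set $S$ of join-irreducibles, $\kappa_L(S)=\{\kappa_L(j):j\in S\}$. *)

theory Defs
  imports Main
begin

text \<open>
  Every lattice occurring in the recursive definition of compatible dismantlability is an interval
  of the lattice one starts with. The notions below are therefore relative to a carrier set
  \<open>A\<close> inside a lattice type, and \<open>A\<close> is meant to be \<open>UNIV\<close> or an interval; in that case
  \<open>\<sqinter>\<close> and \<open>\<squnion>\<close> of the type are also the meet and join of \<open>A\<close>. They are used for finite \<open>A\<close> only.
\<close>

unbundle lattice_syntax

definition covered_by :: "'a::lattice set \<Rightarrow> 'a \<Rightarrow> 'a \<Rightarrow> bool" where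
  "covered_by A x y \<longleftrightarrow> x \<in> A \<and> y \<in> A \<and> x < y \<and> \<not> (\<exists>z\<in>A. x < z \<and> z < y)"

definition join_irr :: "'a::lattice set \<Rightarrow> 'a set" where
  "join_irr A = {j \<in> A. \<exists>!x. covered_by A x j}"

definition meet_irr :: "'a::lattice set \<Rightarrow> 'a set" where
  "meet_irr A = {m \<in> A. \<exists>!x. covered_by A m x}"

definition lower_star :: "'a::lattice set \<Rightarrow> 'a \<Rightarrow> 'a" where
  "lower_star A j = (THE x. covered_by A x j)"

definition upper_star :: "'a::lattice set \<Rightarrow> 'a \<Rightarrow> 'a" where
  "upper_star A m = (THE x. covered_by A m x)"

text \<open>
  \<open>max\<close> and \<open>min\<close> of a subset of a lattice denote its \<^emph>\<open>sets\<close> of maximal and minimal elements.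
\<close>

definition max_elems :: "'a::order set \<Rightarrow> 'a set" where
  "max_elems S = {z \<in> S. \<forall>w\<in>S. z \<le> w \<longrightarrow> w = z}"

definition min_elems :: "'a::order set \<Rightarrow> 'a set" where
  "min_elems S = {z \<in> S. \<forall>w\<in>S. w \<le> z \<longrightarrow> w = z}"

text \<open>These are $\mathcal{M}_L(j)$ and $\mathcal{J}_L(m)$.\<close>

definition meet_partners :: "'a::lattice set \<Rightarrow> 'a \<Rightarrow> 'a set" where
  "meet_partners A j = max_elems {z \<in> A. lower_star A j = j \<sqinter> z}"

definition join_partners :: "'a::lattice set \<Rightarrow> 'a \<Rightarrow> 'a set" where
  "join_partners A m = min_elems {z \<in> A. upper_star A m = m \<squnion> z}"

text \<open>
  A pairing is a function with domain \<open>join_irr A\<close>; being \<open>undefined\<close> outside of it makes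
  uniqueness of pairings meaningful.
\<close>

definition pairing :: "'a::lattice set \<Rightarrow> ('a \<Rightarrow> 'a) \<Rightarrow> bool" where
  "pairing A \<kappa> \<longleftrightarrow>
     bij_betw \<kappa> (join_irr A) (meet_irr A) \<and>
     (\<forall>j. j \<notin> join_irr A \<longrightarrow> \<kappa> j = undefined) \<and>
     (\<forall>j\<in>join_irr A. \<kappa> j \<in> meet_partners A j) \<and>
     (\<forall>m\<in>meet_irr A. inv_into (join_irr A) \<kappa> m \<in> join_partners A m)"

definition uniquely_paired :: "'a::lattice set \<Rightarrow> bool" where
  "uniquely_paired A \<longleftrightarrow> (\<exists>!\<kappa>. pairing A \<kappa>)"

definition kappa :: "'a::lattice set \<Rightarrow> 'a \<Rightarrow> 'a" where
  "kappa A = (THE \<kappa>. pairing A \<kappa>)"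

definition kappa_inv :: "'a::lattice set \<Rightarrow> 'a \<Rightarrow> 'a" where
  "kappa_inv A = inv_into (join_irr A) (kappa A)"

text \<open>
  With \<open>A\<close> an interval, \<open>down A m\<^sub>0\<close> is the interval from its least element to \<open>m\<^sub>0\<close>, and
  \<open>up A j\<^sub>0\<close> the one from \<open>j\<^sub>0\<close> to its greatest element.
\<close>

definition down :: "'a::lattice set \<Rightarrow> 'a \<Rightarrow> 'a set" where
  "down A m = {z \<in> A. z \<le> m}"

definition up :: "'a::lattice set \<Rightarrow> 'a \<Rightarrow> 'a set" where
  "up A j = {z \<in> A. j \<le> z}"

definition prime_pair :: "'a::lattice set \<Rightarrow> 'a \<Rightarrow> 'a \<Rightarrow> bool" where
  "prime_pair A j\<^sub>0 m\<^sub>0 \<longleftrightarrow>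
     j\<^sub>0 \<in> A \<and> m\<^sub>0 \<in> A \<and> A = down A m\<^sub>0 \<union> up A j\<^sub>0 \<and> down A m\<^sub>0 \<inter> up A j\<^sub>0 = {}"

definition dismantle_up :: "'a::lattice set \<Rightarrow> 'a \<Rightarrow> bool" where
  "dismantle_up A j\<^sub>0 \<longleftrightarrow>
     bij_betw (\<lambda>j. j\<^sub>0 \<squnion> j) {j \<in> join_irr A. j\<^sub>0 \<le> kappa A j} (join_irr (up A j\<^sub>0)) \<and>
     (\<forall>j\<in>join_irr A. j\<^sub>0 \<le> kappa A j \<longrightarrow> kappa (up A j\<^sub>0) (j\<^sub>0 \<squnion> j) = kappa A j)"

definition dismantle_down :: "'a::lattice set \<Rightarrow> 'a \<Rightarrow> bool" where
  "dismantle_down A m\<^sub>0 \<longleftrightarrow>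
     bij_betw (\<lambda>m. m\<^sub>0 \<sqinter> m) {m \<in> meet_irr A. kappa_inv A m \<le> m\<^sub>0} (meet_irr (down A m\<^sub>0)) \<and>
     (\<forall>m\<in>meet_irr A. kappa_inv A m \<le> m\<^sub>0 \<longrightarrow>
        kappa_inv (down A m\<^sub>0) (m\<^sub>0 \<sqinter> m) = kappa_inv A m)"

inductive compatibly_dismantlable :: "'a::lattice set \<Rightarrow> bool" where
  singleton: "compatibly_dismantlable A"
    if "uniquely_paired A" and "card A = 1"
| step: "compatibly_dismantlable A"
    if "uniquely_paired A" and "prime_pair A j\<^sub>0 m\<^sub>0"
      and "compatibly_dismantlable (up A j\<^sub>0)" and "dismantle_up A j\<^sub>0"
      and "compatibly_dismantlable (down A m\<^sub>0)" and "dismantle_down A m\<^sub>0"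

definition galois_graph :: "'a::lattice set \<Rightarrow> 'a rel" where
  "galois_graph A =
     {(j, j'). j \<in> join_irr A \<and> j' \<in> join_irr A \<and> j \<noteq> j' \<and> \<not> j \<le> kappa A j'}"

definition independent_set :: "'a::lattice set \<Rightarrow> 'a set \<Rightarrow> bool" where
  "independent_set A S \<longleftrightarrow>
     S \<subseteq> join_irr A \<and> (\<forall>j\<in>S. \<forall>j'\<in>S. (j, j') \<notin> galois_graph A)"

definition J_set :: "'a::lattice set \<Rightarrow> 'a \<Rightarrow> 'a set" where
  "J_set A x = {j \<in> join_irr A. j \<le> x}"

definition M_set :: "'a::lattice set \<Rightarrow> 'a \<Rightarrow> 'a set" where
  "M_set A x = {j \<in> join_irr A. x \<le> kappa A j}"

text \<open>The label $j_{xy}$ of a cover; it is well defined when \<open>A\<close> is compatibly dismantlable.\<close>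

definition cover_label :: "'a::lattice set \<Rightarrow> 'a \<Rightarrow> 'a \<Rightarrow> 'a" where
  "cover_label A x y = (THE j. j \<in> M_set A x \<inter> J_set A y)"

definition down_labels :: "'a::lattice set \<Rightarrow> 'a \<Rightarrow> 'a set" where
  "down_labels A x = {cover_label A y x | y. covered_by A y x}"

definition up_labels :: "'a::lattice set \<Rightarrow> 'a \<Rightarrow> 'a set" where
  "up_labels A x = {cover_label A x y | y. covered_by A x y}"

definition semidistrim :: "'a::lattice set \<Rightarrow> bool" where
  "semidistrim A \<longleftrightarrow>
     compatibly_dismantlable A \<and>
     (\<forall>x\<in>A. independent_set A (down_labels A x) \<and> independent_set A (up_labels A x))"

text \<open>
  Both maps are well defined when \<open>A\<close> is semidistrim: \<open>down_labels A\<close> and \<open>up_labels A\<close> are then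
  bijections from \<open>A\<close> to the independent sets of the Galois graph.
\<close>

definition rowmotion :: "'a::lattice set \<Rightarrow> 'a \<Rightarrow> 'a" where
  "rowmotion A x = (THE y. y \<in> A \<and> up_labels A y = down_labels A x)"

definition rowmotion_inv :: "'a::lattice set \<Rightarrow> 'a \<Rightarrow> 'a" where
  "rowmotion_inv A = inv_into A (rowmotion A)"

definition pop_down :: "'a::complete_lattice \<Rightarrow> 'a" where
  "pop_down x = x \<sqinter> \<Sqinter> {y. covered_by UNIV y x}"

definition pop_up :: "'a::complete_lattice \<Rightarrow> 'a" where
  "pop_up x = x \<squnion> \<Squnion> {y. covered_by UNIV x y}"

end

theory Submission
  imports Defs
begin

text \<open>
  The label $j$ of a cover $x \lessdot y$ satisfies $j \le y$, $x \le \kappa(j)$ and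
  $j \not\le \kappa(j)$. Hence $y \wedge \kappa(j) = x$ and $x \vee j = y$, which gives the formulas
  for the two pop maps, and it also follows that $x$ is the join of its down labels and the meet of
  $\kappa$ of its up labels. So the labellings are injective, and the formulas for rowmotion hold as
  soon as every independent set $I$ is the set of up labels of some element.

  The latter is shown by induction along a prime pair $(j_0, m_0)$. The vertices $j$ with
  $j_0 \le \kappa(j)$ carry the Galois graph of $[j_0, \hat 1]$, those with $j \le m_0$ carry that of
  $[\hat 0, m_0]$, and an independent set avoiding $j_0$ lies in one of these two vertex sets. If
  $j_0 \in I$, then $I - \{j_0\}$ lies in both, hence is realised in both intervals; by injectivity
  the realisation in $[\hat 0, m_0]$ must have the additional label $j_0$ in $L$.
\<close>

section \<open>Covers in finite sublattices\<close>

locale finite_sublattice =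
  fixes A :: "'a::lattice set"
  assumes finite_carrier: "finite A"
    and inf_closed: "x \<in> A \<Longrightarrow> y \<in> A \<Longrightarrow> x \<sqinter> y \<in> A"
    and sup_closed: "x \<in> A \<Longrightarrow> y \<in> A \<Longrightarrow> x \<squnion> y \<in> A"
begin

lemma cover_above:
  assumes "x \<in> A" "z \<in> A" "x < z"
  obtains w where "covered_by A x w" "w \<le> z"
proof -
  let ?S = "{w \<in> A. x < w \<and> w \<le> z}"
  have "finite ?S" "z \<in> ?S" using finite_carrier assms by auto
  then obtain w where w: "w \<in> ?S" "\<And>v. v \<in> ?S \<Longrightarrow> v \<le> w \<Longrightarrow> v = w"
    using finite_has_minimal2[of ?S z] by blast
  have "covered_by A x w"
    unfolding covered_by_def using w(1) w(2) assms(1) order.trans less_imp_le less_irrefl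
    by (metis (mono_tags, lifting) mem_Collect_eq)
  then show thesis using that w by blast
qed

lemma cover_below:
  assumes "x \<in> A" "z \<in> A" "z < x"
  obtains w where "covered_by A w x" "z \<le> w"
proof -
  let ?S = "{w \<in> A. w < x \<and> z \<le> w}"
  have "finite ?S" "z \<in> ?S" using finite_carrier assms by auto
  then obtain w where w: "w \<in> ?S" "\<And>v. v \<in> ?S \<Longrightarrow> w \<le> v \<Longrightarrow> v = w"
    using finite_has_maximal2[of ?S z] by blast
  have "covered_by A w x"
    unfolding covered_by_def using w(1) w(2) assms(1) order.trans less_imp_le less_irrefl
    by (metis (mono_tags, lifting) mem_Collect_eq)
  then show thesis using that w by blast
qed

lemma lower_star_covered: "j \<in> join_irr A \<Longrightarrow> covered_by A (lower_star A j) j"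
  unfolding join_irr_def lower_star_def by (auto intro: theI')

text \<open>By finiteness \<open>z\<close> lies below some element covered by \<open>j\<close>, and
  a join-irreducible covers only one element.\<close>

lemma le_lower_star:
  assumes "j \<in> join_irr A" "z \<in> A" "z < j"
  shows "z \<le> lower_star A j"
proof -
  have "j \<in> A" using assms by (simp add: join_irr_def)
  then obtain w where w: "covered_by A w j" "z \<le> w" using cover_below assms by metis
  moreover have "w = lower_star A j"
    using w lower_star_covered[OF assms(1)] assms(1) unfolding join_irr_def by blast
  ultimately show ?thesis by simp
qed

lemma finite_sublattice_up: "finite_sublattice (up A j)"
  by unfold_locales (auto simp: up_def finite_carrier inf_closed sup_closed le_supI1)

lemma finite_sublattice_down: "finite_sublattice (down A m)"
  by unfold_locales (auto simp: down_def finite_carrier inf_closed sup_closed le_infI1)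

end

section \<open>The unique pairing\<close>

locale paired_sublattice = finite_sublattice +
  assumes unique: "uniquely_paired A"
begin

abbreviation "\<kappa> \<equiv> kappa A"

lemma pairing_kappa: "pairing A \<kappa>"
  using unique unfolding uniquely_paired_def kappa_def by (rule theI')

lemma kappa_bij: "bij_betw \<kappa> (join_irr A) (meet_irr A)"
  using pairing_kappa by (simp add: pairing_def)

lemma kappa_inv_kappa: "j \<in> join_irr A \<Longrightarrow> kappa_inv A (\<kappa> j) = j"
  unfolding kappa_inv_def using kappa_bij by (simp add: bij_betw_inv_into_left)

lemma kappa_kappa_inv: "m \<in> meet_irr A \<Longrightarrow> \<kappa> (kappa_inv A m) = m"
  unfolding kappa_inv_def using kappa_bij by (simp add: bij_betw_inv_into_right)

lemma kappa_inv_bij: "bij_betw (kappa_inv A) (meet_irr A) (join_irr A)"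
  unfolding kappa_inv_def by (rule bij_betw_inv_into[OF kappa_bij])

lemma kappa_partner: "j \<in> join_irr A \<Longrightarrow> \<kappa> j \<in> meet_partners A j"
  using pairing_kappa by (simp add: pairing_def)

lemma kappa_in: "j \<in> join_irr A \<Longrightarrow> \<kappa> j \<in> A"
  and lower_star_kappa: "j \<in> join_irr A \<Longrightarrow> lower_star A j = j \<sqinter> \<kappa> j"
  using kappa_partner by (auto simp: meet_partners_def max_elems_def)

text \<open>If \<open>j\<close> were below \<open>\<kappa> j\<close>, then
  \<open>j \<sqinter> \<kappa> j\<close> would be \<open>j\<close> itself, whereas the pairing makes
  it the element covered by \<open>j\<close>.\<close>

lemma not_le_kappa: "j \<in> join_irr A \<Longrightarrow> \<not> j \<le> \<kappa> j"
  using lower_star_covered[of j] lower_star_kappa[of j]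
  by (auto simp: covered_by_def less_le_not_le)

lemma label_not_le: "j \<in> M_set A x \<Longrightarrow> \<not> j \<le> x"
  unfolding M_set_def using not_le_kappa order.trans by blast

end

section \<open>Uniquely labelled covers and injectivity of the labellings\<close>

locale labelled_sublattice = paired_sublattice +
  assumes overlapping: "covered_by A x y \<Longrightarrow> \<exists>!j. j \<in> M_set A x \<inter> J_set A y"
begin

lemma cover_label_mem: "covered_by A x y \<Longrightarrow> cover_label A x y \<in> M_set A x \<inter> J_set A y"
  unfolding cover_label_def by (rule theI', rule overlapping)

lemma cover_label_eqI:
  "covered_by A x y \<Longrightarrow> j \<in> M_set A x \<Longrightarrow> j \<in> J_set A y \<Longrightarrow> cover_label A x y = j"
  using overlapping[of x y] cover_label_mem[of x y] by blast

lemma up_labels_subset: "up_labels A x \<subseteq> M_set A x"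
  using cover_label_mem by (fastforce simp: up_labels_def)

lemma down_labels_subset: "down_labels A x \<subseteq> J_set A x"
  using cover_label_mem by (fastforce simp: down_labels_def)

text \<open>Otherwise some cover \<open>w\<close> of \<open>x\<close> lies below
  \<open>x \<squnion> y\<close>. Its label \<open>j\<close> has both \<open>x\<close> and
  \<open>y\<close> below \<open>\<kappa> j\<close>, so
  \<open>j \<le> w \<le> x \<squnion> y \<le> \<kappa> j\<close>, which is impossible. With
  \<open>y\<close> taken to be the meet of \<open>\<kappa>\<close> of the labels this also recovers
  \<open>x\<close> from its up labels.\<close>

lemma le_of_up_labels:
  assumes "x \<in> A" "y \<in> A" "up_labels A x \<subseteq> M_set A y"
  shows "y \<le> x"
proof (rule ccontr)
  assume "\<not> y \<le> x"
  then have "x < x \<squnion> y" by (simp add: less_le) (metis sup.cobounded2)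
  then obtain w where w: "covered_by A x w" "w \<le> x \<squnion> y"
    using cover_above assms sup_closed by metis
  let ?j = "cover_label A x w"
  have j: "?j \<in> M_set A x" "?j \<le> w" "?j \<in> join_irr A"
    using cover_label_mem[OF w(1)] by (auto simp: J_set_def)
  have "?j \<in> M_set A y" using assms(3) w(1) by (auto simp: up_labels_def)
  then have "x \<squnion> y \<le> \<kappa> ?j" using j(1) by (simp add: M_set_def)
  then show False using j w(2) not_le_kappa order.trans by metis
qed

text \<open>Dual argument: a lower cover \<open>w\<close> of \<open>x\<close> above
  \<open>x \<sqinter> y\<close> would have a label below both \<open>x\<close> and \<open>y\<close>,
  hence below \<open>w\<close>, although \<open>w\<close> lies below \<open>\<kappa>\<close> of that
  label.\<close>

lemma le_of_down_labels:
  assumes "x \<in> A" "y \<in> A" "down_labels A x \<subseteq> J_set A y"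
  shows "x \<le> y"
proof (rule ccontr)
  assume "\<not> x \<le> y"
  then have "x \<sqinter> y < x" by (simp add: less_le) (metis inf.cobounded2)
  then obtain w where w: "covered_by A w x" "x \<sqinter> y \<le> w"
    using cover_below assms inf_closed by metis
  let ?j = "cover_label A w x"
  have j: "?j \<in> M_set A w" "?j \<le> x"
    using cover_label_mem[OF w(1)] by (auto simp: J_set_def)
  have "?j \<in> J_set A y" using assms(3) w(1) by (auto simp: down_labels_def)
  then have "?j \<le> x \<sqinter> y" using j(2) by (simp add: J_set_def)
  then show False using j(1) w(2) label_not_le order.trans by metis
qed

text \<open>Equal label sets satisfy the comparison criterion in both directions.\<close>

lemma up_labels_inj: "inj_on (up_labels A) A"
  by (rule inj_onI) (metis order.antisym le_of_up_labels up_labels_subset)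

lemma down_labels_inj: "inj_on (down_labels A) A"
  by (rule inj_onI) (metis order.antisym le_of_down_labels down_labels_subset)

end

section \<open>Comparing a lattice with the two intervals of a prime pair\<close>

locale dismantling = paired_sublattice +
  fixes j\<^sub>0 m\<^sub>0
  assumes prime: "prime_pair A j\<^sub>0 m\<^sub>0"
    and unique_up: "uniquely_paired (up A j\<^sub>0)" and dis_up: "dismantle_up A j\<^sub>0"
    and unique_down: "uniquely_paired (down A m\<^sub>0)" and dis_down: "dismantle_down A m\<^sub>0"
begin

sublocale U: paired_sublattice "up A j\<^sub>0"
  by (intro paired_sublattice.intro finite_sublattice_up paired_sublattice_axioms.intro unique_up)

sublocale D: paired_sublattice "down A m\<^sub>0"
  by (intro paired_sublattice.intro finite_sublattice_down paired_sublattice_axioms.intro unique_down)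

lemma j0_in: "j\<^sub>0 \<in> A" and m0_in: "m\<^sub>0 \<in> A"
  using prime by (auto simp: prime_pair_def)

lemma not_j0_le_iff: "z \<in> A \<Longrightarrow> \<not> j\<^sub>0 \<le> z \<longleftrightarrow> z \<le> m\<^sub>0"
  using prime by (auto simp: prime_pair_def up_def down_def)

lemma not_j0_le_m0: "\<not> j\<^sub>0 \<le> m\<^sub>0"
  using not_j0_le_iff m0_in by blast

text \<open>An element strictly below \<open>j\<^sub>0\<close> is not above
  \<open>j\<^sub>0\<close>, so the partition puts it below \<open>m\<^sub>0\<close>. Thus
  \<open>j\<^sub>0 \<sqinter> m\<^sub>0\<close> is the greatest element strictly below
  \<open>j\<^sub>0\<close>.\<close>

lemma covered_j0_iff: "covered_by A w j\<^sub>0 \<longleftrightarrow> w = j\<^sub>0 \<sqinter> m\<^sub>0"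
proof -
  have below: "z \<le> j\<^sub>0 \<sqinter> m\<^sub>0" if "z \<in> A" "z < j\<^sub>0" for z
    using that not_j0_le_iff[of z] by (simp add: less_le_not_le)
  have mem: "j\<^sub>0 \<sqinter> m\<^sub>0 \<in> A" "j\<^sub>0 \<sqinter> m\<^sub>0 < j\<^sub>0"
    using inf_closed j0_in m0_in not_j0_le_m0 by (auto simp: less_le_not_le)
  show ?thesis
  proof
    assume "covered_by A w j\<^sub>0"
    then show "w = j\<^sub>0 \<sqinter> m\<^sub>0"
      using below[of w] mem unfolding covered_by_def by (metis le_less)
  next
    assume "w = j\<^sub>0 \<sqinter> m\<^sub>0"
    then show "covered_by A w j\<^sub>0"
      using below mem j0_in unfolding covered_by_def by (metis leD)
  qed
qed

lemma j0_join_irr: "j\<^sub>0 \<in> join_irr A"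
  by (simp add: join_irr_def j0_in covered_j0_iff)

text \<open>Since \<open>\<kappa> j\<^sub>0\<close> is not above \<open>j\<^sub>0\<close>, it is
  below \<open>m\<^sub>0\<close>. But \<open>m\<^sub>0\<close> satisfies the equation among whose
  solutions \<open>\<kappa> j\<^sub>0\<close> is maximal.\<close>

lemma kappa_j0: "\<kappa> j\<^sub>0 = m\<^sub>0"
proof -
  have ls: "lower_star A j\<^sub>0 = j\<^sub>0 \<sqinter> m\<^sub>0"
    by (simp add: lower_star_def covered_j0_iff)
  have "\<kappa> j\<^sub>0 \<le> m\<^sub>0"
    using not_le_kappa[OF j0_join_irr] not_j0_le_iff kappa_in[OF j0_join_irr] by blast
  then show ?thesis
    using kappa_partner[OF j0_join_irr] ls m0_in by (auto simp: meet_partners_def max_elems_def)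
qed

text \<open>If \<open>j\<^sub>0 < j\<close>, then \<open>j\<^sub>0\<close> is below the element
  covered by \<open>j\<close>, hence below \<open>\<kappa> j\<close> and so below
  \<open>m\<^sub>0\<close>, a contradiction.\<close>

lemma eq_j0:
  assumes "j \<in> join_irr A" "j\<^sub>0 \<le> j" "\<kappa> j \<le> m\<^sub>0"
  shows "j = j\<^sub>0"
proof (rule ccontr)
  assume "j \<noteq> j\<^sub>0"
  then have "j\<^sub>0 \<le> lower_star A j" using assms le_lower_star j0_in by auto
  also have "\<dots> \<le> \<kappa> j" using lower_star_kappa assms(1) by simp
  finally show False using assms(3) not_j0_le_m0 order.trans by blast
qed

text \<open>These vertices represent those of the Galois graph of the upper interval via
  \<open>j \<mapsto> j\<^sub>0 \<squnion> j\<close>; the vertices of the lower interval are the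
  elements of \<open>down_verts\<close> themselves.\<close>

definition up_verts where "up_verts = {j \<in> join_irr A. j\<^sub>0 \<le> \<kappa> j}"
definition down_verts where "down_verts = {j \<in> join_irr A. j \<le> m\<^sub>0}"

lemma join_irr_up: "bij_betw (\<lambda>j. j\<^sub>0 \<squnion> j) up_verts (join_irr (up A j\<^sub>0))"
  using dis_up by (simp add: dismantle_up_def up_verts_def)

lemma kappa_up: "j \<in> up_verts \<Longrightarrow> kappa (up A j\<^sub>0) (j\<^sub>0 \<squnion> j) = \<kappa> j"
  using dis_up by (simp add: dismantle_up_def up_verts_def)

text \<open>The dismantling condition for the lower interval speaks of meet-irreducibles and
  \<open>kappa_inv\<close>; applying it to \<open>m = \<kappa> j\<close> turns it into a statement
  about join-irreducibles.\<close>

lemma kappa_down: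
  assumes "j \<in> down_verts"
  shows "j \<in> join_irr (down A m\<^sub>0)" "kappa (down A m\<^sub>0) j = m\<^sub>0 \<sqinter> \<kappa> j"
proof -
  have j: "j \<in> join_irr A" "j \<le> m\<^sub>0" using assms by (auto simp: down_verts_def)
  have m: "\<kappa> j \<in> meet_irr A" "kappa_inv A (\<kappa> j) = j"
    using j kappa_bij kappa_inv_kappa by (auto simp: bij_betw_def)
  have "\<kappa> j \<in> {m \<in> meet_irr A. kappa_inv A m \<le> m\<^sub>0}" using m j(2) by simp
  then have m': "m\<^sub>0 \<sqinter> \<kappa> j \<in> meet_irr (down A m\<^sub>0)"
    using dis_down unfolding dismantle_down_def by (blast dest: bij_betw_apply)
  have inv: "kappa_inv (down A m\<^sub>0) (m\<^sub>0 \<sqinter> \<kappa> j) = j"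
    using dis_down m j(2) unfolding dismantle_down_def by metis
  show "j \<in> join_irr (down A m\<^sub>0)"
    using bij_betw_apply[OF D.kappa_inv_bij m'] inv by simp
  show "kappa (down A m\<^sub>0) j = m\<^sub>0 \<sqinter> \<kappa> j"
    using D.kappa_kappa_inv[OF m'] inv by simp
qed

text \<open>The bijection on meet-irreducibles preserves \<open>kappa_inv\<close>, so every
  join-irreducible of the lower interval is already \<open>kappa_inv A m\<close> for some
  \<open>m\<close>.\<close>

lemma join_irr_down: "join_irr (down A m\<^sub>0) = down_verts"
proof
  show "join_irr (down A m\<^sub>0) \<subseteq> down_verts"
  proof
    fix j assume "j \<in> join_irr (down A m\<^sub>0)"
    then obtain m' where m': "m' \<in> meet_irr (down A m\<^sub>0)" "j = kappa_inv (down A m\<^sub>0) m'"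
      using D.kappa_inv_bij by (auto simp: bij_betw_def)
    then obtain m where m: "m \<in> meet_irr A" "kappa_inv A m \<le> m\<^sub>0" "m' = m\<^sub>0 \<sqinter> m"
      using dis_down unfolding dismantle_down_def bij_betw_def by auto
    then have "j = kappa_inv A m" using dis_down m'(2) by (simp add: dismantle_down_def)
    then show "j \<in> down_verts"
      using m kappa_inv_bij by (auto simp: down_verts_def bij_betw_def)
  qed
qed (use kappa_down(1) in blast)

text \<open>For \<open>y\<close> above \<open>j\<^sub>0\<close>, the conditions
  \<open>j\<^sub>0 \<squnion> j \<le> y\<close> and \<open>j \<le> y\<close> agree, while
  \<open>\<kappa>\<close> is preserved. Membership in \<open>up_verts\<close> is automatic from
  \<open>j\<^sub>0 \<le> x \<le> \<kappa> j\<close>.\<close>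

lemma labels_up:
  assumes "x \<in> up A j\<^sub>0" "y \<in> up A j\<^sub>0"
  shows "M_set (up A j\<^sub>0) x \<inter> J_set (up A j\<^sub>0) y = (\<lambda>j. j\<^sub>0 \<squnion> j) ` (M_set A x \<inter> J_set A y)"
    (is "?L = ?f ` ?R")
proof -
  have xy: "j\<^sub>0 \<le> x" "j\<^sub>0 \<le> y" using assms by (auto simp: up_def)
  have "?L = {j' \<in> ?f ` up_verts. x \<le> kappa (up A j\<^sub>0) j' \<and> j' \<le> y}"
    using join_irr_up by (auto simp: M_set_def J_set_def bij_betw_def)
  also have "\<dots> = ?f ` {j \<in> up_verts. x \<le> \<kappa> j \<and> j \<le> y}"
    using kappa_up xy by auto
  also have "{j \<in> up_verts. x \<le> \<kappa> j \<and> j \<le> y} = ?R"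
    using xy by (auto simp: M_set_def J_set_def up_verts_def)
  finally show ?thesis .
qed

lemma labels_down:
  assumes "x \<in> down A m\<^sub>0" "y \<in> down A m\<^sub>0"
  shows "M_set (down A m\<^sub>0) x \<inter> J_set (down A m\<^sub>0) y = M_set A x \<inter> J_set A y"
proof -
  have "x \<le> m\<^sub>0" "y \<le> m\<^sub>0" using assms by (auto simp: down_def)
  then show ?thesis
    using kappa_down(2) by (auto simp: M_set_def J_set_def join_irr_down) (auto simp: down_verts_def)
qed

text \<open>A cover that crosses the partition satisfies \<open>x \<squnion> j\<^sub>0 = y\<close>
  and \<open>y \<sqinter> m\<^sub>0 = x\<close>. For a label \<open>j\<close>, having
  \<open>j\<^sub>0 \<le> \<kappa> j\<close> would put \<open>y\<close>, and having
  \<open>j \<le> m\<^sub>0\<close> would put \<open>j \<le> x\<close>, below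
  \<open>\<kappa> j\<close>. Both are impossible, so \<open>eq_j0\<close> applies.\<close>

lemma labels_mixed:
  assumes cov: "covered_by A x y" and x: "x \<le> m\<^sub>0" and y: "j\<^sub>0 \<le> y"
  shows "M_set A x \<inter> J_set A y = {j\<^sub>0}"
proof -
  have A: "x \<in> A" "y \<in> A" "x < y" and max: "\<And>z. z \<in> A \<Longrightarrow> x \<le> z \<Longrightarrow> z < y \<Longrightarrow> z = x"
    and min: "\<And>z. z \<in> A \<Longrightarrow> x < z \<Longrightarrow> z \<le> y \<Longrightarrow> z = y"
    using cov unfolding covered_by_def by (auto simp: le_less)
  have "\<not> j\<^sub>0 \<le> x" using x not_j0_le_m0 order.trans by blast
  then have "x < x \<squnion> j\<^sub>0" by (simp add: less_le) (metis sup.cobounded2)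
  then have join: "x \<squnion> j\<^sub>0 = y"
    using min[of "x \<squnion> j\<^sub>0"] A y sup_closed j0_in by simp
  have "\<not> y \<le> m\<^sub>0" using y not_j0_le_m0 order.trans by blast
  then have "y \<sqinter> m\<^sub>0 < y" by (simp add: less_le) (metis inf.cobounded2)
  then have meet: "y \<sqinter> m\<^sub>0 = x"
    using max[of "y \<sqinter> m\<^sub>0"] A x inf_closed m0_in by simp
  have "j = j\<^sub>0" if j: "j \<in> join_irr A" "x \<le> \<kappa> j" "j \<le> y" for j
  proof (rule eq_j0[OF j(1)])
    have jA: "j \<in> A" using j by (simp add: join_irr_def)
    show "\<kappa> j \<le> m\<^sub>0"
    proof (rule ccontr)
      assume "\<not> \<kappa> j \<le> m\<^sub>0"
      then have "j\<^sub>0 \<le> \<kappa> j" using not_j0_le_iff kappa_in[OF j(1)] by blast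
      then have "y \<le> \<kappa> j" using join j(2) by auto
      then show False using j not_le_kappa order.trans by blast
    qed
    show "j\<^sub>0 \<le> j"
    proof (rule ccontr)
      assume "\<not> j\<^sub>0 \<le> j"
      then have "j \<le> x" using not_j0_le_iff jA j(3) meet by auto
      then show False using j not_le_kappa order.trans by blast
    qed
  qed
  then have "M_set A x \<inter> J_set A y \<subseteq> {j\<^sub>0}" unfolding M_set_def J_set_def by blast
  moreover have "j\<^sub>0 \<in> M_set A x \<inter> J_set A y"
    using j0_join_irr kappa_j0 x y by (simp add: M_set_def J_set_def)
  ultimately show ?thesis by blast
qed

lemma covered_up:
  "x \<in> up A j\<^sub>0 \<Longrightarrow> covered_by (up A j\<^sub>0) x y \<longleftrightarrow> covered_by A x y"
  unfolding covered_by_def up_def by (auto intro: order.trans less_imp_le)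

lemma covered_down:
  "y \<in> down A m\<^sub>0 \<Longrightarrow> covered_by (down A m\<^sub>0) x y \<longleftrightarrow> covered_by A x y"
  unfolding covered_by_def down_def by (auto intro: order.trans less_imp_le)

text \<open>As \<open>j\<^sub>0 \<le> \<kappa> j'\<close>, joining \<open>j\<close> with
  \<open>j\<^sub>0\<close> does not affect whether it lies below \<open>\<kappa> j'\<close>.\<close>

lemma galois_up:
  assumes "j \<in> up_verts" "j' \<in> up_verts"
  shows "(j\<^sub>0 \<squnion> j, j\<^sub>0 \<squnion> j') \<in> galois_graph (up A j\<^sub>0) \<longleftrightarrow> (j, j') \<in> galois_graph A"
proof -
  have "j\<^sub>0 \<squnion> j = j\<^sub>0 \<squnion> j' \<longleftrightarrow> j = j'"
    and "j\<^sub>0 \<squnion> j \<in> join_irr (up A j\<^sub>0)" "j\<^sub>0 \<squnion> j' \<in> join_irr (up A j\<^sub>0)"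
    using join_irr_up assms by (auto simp: bij_betw_def inj_on_def)
  then show ?thesis
    using assms kappa_up[OF assms(2)] by (auto simp: galois_graph_def up_verts_def)
qed

lemma galois_down:
  assumes "j \<in> down_verts" "j' \<in> down_verts"
  shows "(j, j') \<in> galois_graph (down A m\<^sub>0) \<longleftrightarrow> (j, j') \<in> galois_graph A"
  using assms kappa_down[OF assms(2)]
  by (auto simp: galois_graph_def join_irr_down) (auto simp: down_verts_def)

lemma independent_up:
  assumes "S \<subseteq> up_verts"
  shows "independent_set (up A j\<^sub>0) ((\<lambda>j. j\<^sub>0 \<squnion> j) ` S) \<longleftrightarrow> independent_set A S"
proof -
  have "(\<lambda>j. j\<^sub>0 \<squnion> j) ` S \<subseteq> join_irr (up A j\<^sub>0)" "S \<subseteq> join_irr A"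
    using join_irr_up assms by (auto simp: bij_betw_def up_verts_def)
  then show ?thesis
    using galois_up assms unfolding independent_set_def by (auto simp: subset_iff)
qed

lemma independent_down:
  assumes "S \<subseteq> down_verts"
  shows "independent_set (down A m\<^sub>0) S \<longleftrightarrow> independent_set A S"
proof -
  have "S \<subseteq> join_irr A" using assms by (auto simp: down_verts_def)
  then show ?thesis
    using galois_down assms unfolding independent_set_def by (auto simp: subset_iff join_irr_down)
qed

text \<open>The absence of an edge from \<open>j\<^sub>0\<close> to \<open>j\<close> says
  \<open>j\<^sub>0 \<le> \<kappa> j\<close>; the absence of the reverse edge says
  \<open>j \<le> \<kappa> j\<^sub>0 = m\<^sub>0\<close>.\<close>

lemma up_verts_if_independent:
  assumes "independent_set A S" "j\<^sub>0 \<in> S"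
  shows "S - {j\<^sub>0} \<subseteq> up_verts" "S - {j\<^sub>0} \<subseteq> down_verts"
  using assms kappa_j0 unfolding independent_set_def galois_graph_def up_verts_def down_verts_def
  by auto

text \<open>A vertex \<open>j\<close> outside \<open>up_verts\<close> has
  \<open>\<kappa> j \<le> m\<^sub>0\<close>, and a vertex \<open>j'\<close> outside
  \<open>down_verts\<close> has \<open>j\<^sub>0 \<le> j'\<close>. So \<open>j'\<close> is not below
  \<open>\<kappa> j\<close>, which is an edge unless the two coincide, and then \<open>eq_j0\<close>
  identifies them with \<open>j\<^sub>0\<close>.\<close>

lemma independent_cases:
  assumes "independent_set A S" "j\<^sub>0 \<notin> S"
  shows "S \<subseteq> up_verts \<or> S \<subseteq> down_verts"
proof (rule ccontr)
  assume "\<not> ?thesis"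
  then obtain j j' where j: "j \<in> S" "j \<notin> up_verts" and j': "j' \<in> S" "j' \<notin> down_verts"
    by blast
  have J: "j \<in> join_irr A" "j' \<in> join_irr A"
    using assms(1) j j' by (auto simp: independent_set_def)
  have kj: "\<kappa> j \<le> m\<^sub>0" using j J not_j0_le_iff kappa_in by (auto simp: up_verts_def)
  have "j' \<in> A" using J by (simp add: join_irr_def)
  then have j0: "j\<^sub>0 \<le> j'" using j' J not_j0_le_iff by (auto simp: down_verts_def)
  have "j \<noteq> j'" using eq_j0 J kj j0 assms(2) j by metis
  moreover have "\<not> j' \<le> \<kappa> j" using kj j0 not_j0_le_m0 order.trans by blast
  ultimately show False
    using assms(1) j j' J by (auto simp: independent_set_def galois_graph_def)
qed

text \<open>A cover lies in the upper interval, lies in the lower one, or crosses between them; in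
  the last case its only label is \<open>j\<^sub>0\<close>.\<close>

lemma overlapping_step:
  assumes up: "\<And>x y. covered_by (up A j\<^sub>0) x y \<Longrightarrow> \<exists>!j. j \<in> M_set (up A j\<^sub>0) x \<inter> J_set (up A j\<^sub>0) y"
    and down: "\<And>x y. covered_by (down A m\<^sub>0) x y \<Longrightarrow>
      \<exists>!j. j \<in> M_set (down A m\<^sub>0) x \<inter> J_set (down A m\<^sub>0) y"
    and cov: "covered_by A x y"
  shows "\<exists>!j. j \<in> M_set A x \<inter> J_set A y"
proof -
  have A: "x \<in> A" "y \<in> A" "x < y" using cov by (auto simp: covered_by_def)
  consider "j\<^sub>0 \<le> x" | "y \<le> m\<^sub>0" | "x \<le> m\<^sub>0" "j\<^sub>0 \<le> y" using not_j0_le_iff A by blast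
  then show ?thesis
  proof cases
    case 1
    have xy: "x \<in> up A j\<^sub>0" "y \<in> up A j\<^sub>0" using 1 A by (auto simp: up_def)
    have sub: "M_set A x \<inter> J_set A y \<subseteq> up_verts"
      using 1 by (auto simp: M_set_def up_verts_def)
    \<comment> \<open>Uniqueness holds for the images under joining with \<open>j\<^sub>0\<close>;
      injectivity carries it back to the labels in \<open>A\<close>.\<close>
    have "inj_on (\<lambda>j. j\<^sub>0 \<squnion> j) (M_set A x \<inter> J_set A y)"
      using join_irr_up sub by (meson bij_betw_def inj_on_subset)
    moreover have "\<exists>!j. j \<in> (\<lambda>j. j\<^sub>0 \<squnion> j) ` (M_set A x \<inter> J_set A y)"
      using up[of x y] covered_up[OF xy(1)] cov labels_up[OF xy] by simp
    ultimately show ?thesis unfolding inj_on_def by blast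
  next
    case 2
    then have xy: "x \<in> down A m\<^sub>0" "y \<in> down A m\<^sub>0" using A by (auto simp: down_def)
    then show ?thesis using down[of x y] covered_down[OF xy(2)] cov labels_down[OF xy] by simp
  next
    case 3
    then show ?thesis using labels_mixed[OF cov] by simp
  qed
qed

end

section \<open>Unique labels by induction on the dismantling\<close>

lemma compatibly_dismantlable_uniquely_paired:
  "compatibly_dismantlable A \<Longrightarrow> uniquely_paired A"
  by (auto elim: compatibly_dismantlable.cases)

lemma dismantlingI:
  assumes "finite_sublattice A" "uniquely_paired A" "prime_pair A j\<^sub>0 m\<^sub>0"
    "compatibly_dismantlable (up A j\<^sub>0)" "dismantle_up A j\<^sub>0"
    "compatibly_dismantlable (down A m\<^sub>0)" "dismantle_down A m\<^sub>0"
  shows "dismantling A j\<^sub>0 m\<^sub>0"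
  using assms compatibly_dismantlable_uniquely_paired
  by (intro dismantling.intro paired_sublattice.intro paired_sublattice_axioms.intro
      dismantling_axioms.intro)

lemma not_covered_by_if_card_1:
  assumes "card A = 1"
  shows "\<not> covered_by A x y"
  using assms by (auto simp: card_1_singleton_iff covered_by_def)

lemma compatibly_dismantlable_overlapping:
  assumes "compatibly_dismantlable A" "finite_sublattice A" "covered_by A x y"
  shows "\<exists>!j. j \<in> M_set A x \<inter> J_set A y"
  using assms
proof (induction arbitrary: x y rule: compatibly_dismantlable.induct)
  case (singleton A)
  then show ?case using not_covered_by_if_card_1 by blast
next
  case (step A j\<^sub>0 m\<^sub>0)
  interpret dismantling A j\<^sub>0 m\<^sub>0
    by (rule dismantlingI[OF step.prems(1) step.hyps])
  show ?case
    using overlapping_step step.IH finite_sublattice_up finite_sublattice_down step.prems(2) by blast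
qed

lemma labelled_sublatticeI:
  assumes "compatibly_dismantlable A" "finite_sublattice A"
  shows "labelled_sublattice A"
  using assms compatibly_dismantlable_uniquely_paired compatibly_dismantlable_overlapping
  by (intro labelled_sublattice.intro paired_sublattice.intro paired_sublattice_axioms.intro
      labelled_sublattice_axioms.intro)

section \<open>Realising independent sets as sets of up labels\<close>

locale labelled_dismantling = dismantling + labelled_sublattice +
  assumes labelled_up: "labelled_sublattice (up A j\<^sub>0)"
    and labelled_down: "labelled_sublattice (down A m\<^sub>0)"
begin

sublocale U: labelled_sublattice "up A j\<^sub>0" by (rule labelled_up)
sublocale D: labelled_sublattice "down A m\<^sub>0" by (rule labelled_down)

lemma up_labels_up:
  assumes "x \<in> up A j\<^sub>0"
  shows "up_labels (up A j\<^sub>0) x = (\<lambda>j. j\<^sub>0 \<squnion> j) ` up_labels A x" "up_labels A x \<subseteq> up_verts"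
proof -
  have "cover_label (up A j\<^sub>0) x y = j\<^sub>0 \<squnion> cover_label A x y" if "covered_by A x y" for y
  proof -
    have cov: "covered_by (up A j\<^sub>0) x y" using that covered_up assms by simp
    then have "y \<in> up A j\<^sub>0" by (simp add: covered_by_def)
    then have "j\<^sub>0 \<squnion> cover_label A x y \<in> M_set (up A j\<^sub>0) x \<inter> J_set (up A j\<^sub>0) y"
      using labels_up[OF assms] cover_label_mem[OF that] by simp
    then show ?thesis using U.cover_label_eqI[OF cov] by simp
  qed
  then show "up_labels (up A j\<^sub>0) x = (\<lambda>j. j\<^sub>0 \<squnion> j) ` up_labels A x"
    using covered_up[OF assms] unfolding up_labels_def by force
  show "up_labels A x \<subseteq> up_verts"
    using up_labels_subset assms by (force simp: M_set_def up_def up_verts_def)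
qed

text \<open>Covers of \<open>x\<close> that leave the lower interval carry the label
  \<open>j\<^sub>0\<close>, while those inside it have labels below \<open>m\<^sub>0\<close>, hence
  different from \<open>j\<^sub>0\<close>.\<close>

lemma up_labels_down:
  assumes "x \<in> down A m\<^sub>0"
  shows "up_labels (down A m\<^sub>0) x = up_labels A x - {j\<^sub>0}"
proof -
  have x: "x \<in> A" "x \<le> m\<^sub>0" using assms by (auto simp: down_def)
  have down: "covered_by A x y \<and> cover_label (down A m\<^sub>0) x y = cover_label A x y \<and>
      cover_label A x y \<noteq> j\<^sub>0" if cov: "covered_by (down A m\<^sub>0) x y" for y
  proof -
    have y: "y \<in> down A m\<^sub>0" using that by (simp add: covered_by_def)
    have covA: "covered_by A x y" using that covered_down y by simp
    have mem: "cover_label A x y \<in> M_set A x \<inter> J_set A y" by (rule cover_label_mem[OF covA])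
    then have "cover_label A x y \<le> m\<^sub>0" using y by (auto simp: J_set_def down_def)
    then have "cover_label A x y \<noteq> j\<^sub>0" using not_j0_le_m0 by auto
    moreover have "cover_label (down A m\<^sub>0) x y = cover_label A x y"
      using D.cover_label_eqI[OF cov] mem labels_down[OF assms y] by blast
    ultimately show ?thesis using covA by simp
  qed
  have up: "covered_by (down A m\<^sub>0) x y"
    if "covered_by A x y" "cover_label A x y \<noteq> j\<^sub>0" for y
  proof -
    have "y \<in> A" using that by (simp add: covered_by_def)
    have "\<not> j\<^sub>0 \<le> y" using labels_mixed[OF that(1) x(2)] cover_label_mem[OF that(1)] that(2) by auto
    then have "y \<in> down A m\<^sub>0" using not_j0_le_iff \<open>y \<in> A\<close> by (simp add: down_def)
    then show ?thesis using that covered_down by simp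
  qed
  show ?thesis
  proof (intro set_eqI iffI)
    fix j assume "j \<in> up_labels (down A m\<^sub>0) x"
    then obtain y where "covered_by (down A m\<^sub>0) x y" "j = cover_label (down A m\<^sub>0) x y"
      by (auto simp: up_labels_def)
    then show "j \<in> up_labels A x - {j\<^sub>0}"
      unfolding up_labels_def using down by (metis (mono_tags, lifting) DiffI mem_Collect_eq singletonD)
  next
    fix j assume "j \<in> up_labels A x - {j\<^sub>0}"
    then obtain y where y: "covered_by A x y" "j = cover_label A x y" "j \<noteq> j\<^sub>0"
      by (auto simp: up_labels_def)
    then show "j \<in> up_labels (down A m\<^sub>0) x" unfolding up_labels_def using up down by force
  qed
qed

text \<open>Independence of the up labels passes to both intervals, as the induction hypotheses of
  the realisation argument require.\<close>

context
  assumes independent: "x \<in> A \<Longrightarrow> independent_set A (up_labels A x)"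
begin

lemma independent_up_labels_up:
  "x \<in> up A j\<^sub>0 \<Longrightarrow> independent_set (up A j\<^sub>0) (up_labels (up A j\<^sub>0) x)"
  using up_labels_up independent_up independent by (simp add: up_def)

lemma independent_up_labels_down:
  assumes "x \<in> down A m\<^sub>0"
  shows "independent_set (down A m\<^sub>0) (up_labels (down A m\<^sub>0) x)"
proof -
  have "up_labels (down A m\<^sub>0) x \<subseteq> down_verts"
    using D.up_labels_subset by (auto simp: M_set_def join_irr_down[symmetric])
  moreover have "independent_set A (up_labels A x - {j\<^sub>0})"
    using independent[of x] assms by (auto simp: down_def independent_set_def)
  ultimately show ?thesis using independent_down up_labels_down[OF assms] by simp
qed

lemma realise_step:
  assumes up: "\<And>S. independent_set (up A j\<^sub>0) S \<Longrightarrow> \<exists>x\<in>up A j\<^sub>0. up_labels (up A j\<^sub>0) x = S"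
    and down: "\<And>S. independent_set (down A m\<^sub>0) S \<Longrightarrow> \<exists>x\<in>down A m\<^sub>0. up_labels (down A m\<^sub>0) x = S"
    and S: "independent_set A S"
  shows "\<exists>x\<in>A. up_labels A x = S"
proof -
  have realise_up: "\<exists>x\<in>up A j\<^sub>0. up_labels A x = T"
    if T: "independent_set A T" "T \<subseteq> up_verts" for T
  proof -
    obtain x where x: "x \<in> up A j\<^sub>0" "up_labels (up A j\<^sub>0) x = (\<lambda>j. j\<^sub>0 \<squnion> j) ` T"
      using up independent_up T by blast
    then have "(\<lambda>j. j\<^sub>0 \<squnion> j) ` up_labels A x = (\<lambda>j. j\<^sub>0 \<squnion> j) ` T"
      using up_labels_up(1) by simp
    then have "up_labels A x = T"
      using inj_on_image_eq_iff[of "\<lambda>j. j\<^sub>0 \<squnion> j" up_verts] join_irr_up up_labels_up(2)[OF x(1)] T(2)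
      by (simp add: bij_betw_def)
    then show ?thesis using x by blast
  qed
  \<comment> \<open>The lower interval does not see the label \<open>j\<^sub>0\<close>, so the label
    set in \<open>A\<close> is determined only up to \<open>j\<^sub>0\<close>.\<close>
  have realise_down: "\<exists>x\<in>down A m\<^sub>0. up_labels A x - {j\<^sub>0} = T"
    if "independent_set A T" "T \<subseteq> down_verts" for T
    using down independent_down up_labels_down that by blast
  have carrier: "up A j\<^sub>0 \<subseteq> A" "down A m\<^sub>0 \<subseteq> A" by (auto simp: up_def down_def)
  show ?thesis
  proof (cases "j\<^sub>0 \<in> S")
    case True
    have ind: "independent_set A (S - {j\<^sub>0})" using S by (auto simp: independent_set_def)
    obtain x where x: "x \<in> down A m\<^sub>0" "up_labels A x - {j\<^sub>0} = S - {j\<^sub>0}"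
      using realise_down[OF ind] up_verts_if_independent[OF S True] by blast
    obtain y where y: "y \<in> up A j\<^sub>0" "up_labels A y = S - {j\<^sub>0}"
      using realise_up[OF ind] up_verts_if_independent[OF S True] by blast
    have "x \<noteq> y" using x(1) y(1) prime by (auto simp: prime_pair_def)
    then have "up_labels A x \<noteq> up_labels A y"
      using up_labels_inj x(1) y(1) carrier by (meson inj_onD subsetD)
    \<comment> \<open>Apart from \<open>j\<^sub>0\<close> the label sets of \<open>x\<close> and
      \<open>y\<close> agree, and \<open>y\<close> lacks \<open>j\<^sub>0\<close>; being different,
      \<open>x\<close> must have it.\<close>
    then have "up_labels A x = S" using x(2) y(2) True by blast
    then show ?thesis using x(1) carrier by blast
  next
    case False
    show ?thesis
    proof (cases "S \<subseteq> up_verts")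
      case True
      then show ?thesis using realise_up S carrier by blast
    next
      case nup: False
      then obtain x where x: "x \<in> down A m\<^sub>0" "up_labels A x - {j\<^sub>0} = S"
        using independent_cases[OF S False] realise_down[OF S] by blast
      \<comment> \<open>If \<open>j\<^sub>0\<close> were a label of \<open>x\<close>, independence
        would force the other labels, which form \<open>S\<close>, into
        \<open>up_verts\<close>.\<close>
      then have "j\<^sub>0 \<notin> up_labels A x"
        using up_verts_if_independent(1)[OF independent] carrier nup by blast
      then show ?thesis using x carrier by blast
    qed
  qed
qed

end

end

lemma up_labels_realise:
  assumes "compatibly_dismantlable A" "finite_sublattice A"
    and "\<And>x. x \<in> A \<Longrightarrow> independent_set A (up_labels A x)"
    and "independent_set A S"
  shows "\<exists>x\<in>A. up_labels A x = S"
  using assms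
proof (induction arbitrary: S rule: compatibly_dismantlable.induct)
  case (singleton A)
  then obtain a where a: "a \<in> A" by (metis card_1_singletonE insertI1)
  \<comment> \<open>Without covers there are no join-irreducibles, so only the empty set is
    independent.\<close>
  have "S = {}" "up_labels A a = {}"
    using not_covered_by_if_card_1[OF singleton.hyps(2)] singleton.prems(3)
    by (auto simp: independent_set_def join_irr_def up_labels_def)
  then show ?case using a by blast
next
  case (step A j\<^sub>0 m\<^sub>0)
  interpret dismantling A j\<^sub>0 m\<^sub>0
    by (rule dismantlingI[OF step.prems(1) step.hyps])
  have "compatibly_dismantlable A"
    by (rule compatibly_dismantlable.step[OF step.hyps])
  then interpret labelled_dismantling A j\<^sub>0 m\<^sub>0
    using step.hyps step.prems(1) finite_sublattice_up finite_sublattice_down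
    by (intro labelled_dismantling.intro labelled_dismantling_axioms.intro labelled_sublatticeI
        dismantling_axioms)
  have "\<exists>x\<in>up A j\<^sub>0. up_labels (up A j\<^sub>0) x = T" if "independent_set (up A j\<^sub>0) T" for T
    using step.IH(1) finite_sublattice_up independent_up_labels_up step.prems(2) that by blast
  moreover have "\<exists>x\<in>down A m\<^sub>0. up_labels (down A m\<^sub>0) x = T"
    if "independent_set (down A m\<^sub>0) T" for T
    using step.IH(2) finite_sublattice_down independent_up_labels_down step.prems(2) that by blast
  ultimately show ?case using realise_step step.prems(2,3) by blast
qed

section \<open>Rowmotion and the pop maps\<close>

theorem theorem9p1:
  fixes x :: "'a::{finite, complete_lattice}"
  assumes "semidistrim (UNIV :: 'a set)"
  shows "rowmotion UNIV x = \<Sqinter> (kappa UNIV ` down_labels UNIV x) \<and>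
    rowmotion_inv UNIV x = \<Squnion> (up_labels UNIV x) \<and>
    pop_down x = x \<sqinter> \<Sqinter> (kappa UNIV ` down_labels UNIV x) \<and>
    pop_up x = x \<squnion> \<Squnion> (up_labels UNIV x) \<and>
    pop_down x = x \<sqinter> rowmotion UNIV x \<and>
    pop_up x = x \<squnion> rowmotion_inv UNIV x"
proof -
  have cd: "compatibly_dismantlable (UNIV :: 'a set)"
    and ind: "\<And>y :: 'a. independent_set UNIV (down_labels UNIV y)"
      "\<And>y :: 'a. independent_set UNIV (up_labels UNIV y)"
    using assms by (auto simp: semidistrim_def)
  have fin: "finite_sublattice (UNIV :: 'a set)" by unfold_locales auto
  interpret labelled_sublattice "UNIV :: 'a set" by (rule labelled_sublatticeI[OF cd fin])
  have meet_up: "\<Sqinter> (kappa UNIV ` up_labels UNIV y) = y" for y :: 'a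
  proof (rule order.antisym)
    have "up_labels UNIV y \<subseteq> M_set UNIV (\<Sqinter> (kappa UNIV ` up_labels UNIV y))"
      using up_labels_subset[of y] by (auto simp: M_set_def intro: INF_lower)
    then show "\<Sqinter> (kappa UNIV ` up_labels UNIV y) \<le> y" by (intro le_of_up_labels) auto
    show "y \<le> \<Sqinter> (kappa UNIV ` up_labels UNIV y)"
      using up_labels_subset[of y] by (auto simp: M_set_def intro: INF_greatest)
  qed
  have join_down: "\<Squnion> (down_labels UNIV y) = y" for y :: 'a
  proof (rule order.antisym)
    have "down_labels UNIV y \<subseteq> J_set UNIV (\<Squnion> (down_labels UNIV y))"
      using down_labels_subset[of y] by (auto simp: J_set_def intro: Sup_upper)
    then show "y \<le> \<Squnion> (down_labels UNIV y)" by (intro le_of_down_labels) auto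
    show "\<Squnion> (down_labels UNIV y) \<le> y"
      using down_labels_subset[of y] by (auto simp: J_set_def intro: Sup_least)
  qed
  \<comment> \<open>Existence is realisation applied to the independent set of down labels;
    uniqueness is injectivity of the up labelling. This makes the description in
    \<open>rowmotion\<close> meaningful.\<close>
  have "\<exists>!z. z \<in> UNIV \<and> up_labels UNIV z = down_labels UNIV y" for y :: 'a
    using up_labels_realise[OF cd fin ind(2) ind(1)] up_labels_inj by (metis UNIV_I inj_onD)
  then have row: "up_labels UNIV (rowmotion UNIV y) = down_labels UNIV y" for y :: 'a
    unfolding rowmotion_def by (metis (mono_tags, lifting) theI')
  have row_eq: "rowmotion UNIV x = \<Sqinter> (kappa UNIV ` down_labels UNIV x)"
    using meet_up[of "rowmotion UNIV x"] row[of x] by simp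
  \<comment> \<open>Down labels can be read off from the image under rowmotion and determine the
    element; finiteness then gives surjectivity, so \<open>rowmotion_inv\<close> is a genuine right
    inverse.\<close>
  have "inj (rowmotion (UNIV :: 'a set))"
    by (rule injI) (metis row down_labels_inj injD)
  then have "surj (rowmotion (UNIV :: 'a set))" by (simp add: finite_UNIV_inj_surj)
  then have "rowmotion UNIV (rowmotion_inv UNIV x) = x"
    unfolding rowmotion_inv_def by (rule surj_f_inv_f)
  then have row_inv_eq: "rowmotion_inv UNIV x = \<Squnion> (up_labels UNIV x)"
    using join_down[of "rowmotion_inv UNIV x"] row[of "rowmotion_inv UNIV x"] by simp
  have lab: "cover_label UNIV y z \<in> join_irr UNIV" "y \<le> kappa UNIV (cover_label UNIV y z)"
      "cover_label UNIV y z \<le> z" if "covered_by UNIV y z" for y z :: 'a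
    using cover_label_mem[OF that] by (auto simp: M_set_def J_set_def)
  \<comment> \<open>The meet lies between \<open>y\<close> and \<open>x\<close> and differs from
    \<open>x\<close>, since otherwise the label would be below its own \<open>\<kappa>\<close>; the
    cover leaves only \<open>y\<close>.\<close>
  have meet_cover: "x \<sqinter> kappa UNIV (cover_label UNIV y x) = y" if cov: "covered_by UNIV y x" for y
  proof -
    have "\<not> x \<le> kappa UNIV (cover_label UNIV y x)"
      using lab[OF cov] not_le_kappa order.trans by blast
    then have "x \<sqinter> kappa UNIV (cover_label UNIV y x) < x"
      by (simp add: less_le) (metis inf.cobounded2)
    moreover have "y \<le> x \<sqinter> kappa UNIV (cover_label UNIV y x)"
      using lab[OF cov] cov by (simp add: covered_by_def less_imp_le)
    ultimately show ?thesis using cov by (auto simp: covered_by_def le_less)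
  qed
  have join_cover: "x \<squnion> cover_label UNIV x y = y" if cov: "covered_by UNIV x y" for y
  proof -
    have "\<not> cover_label UNIV x y \<le> x"
      using lab[OF cov] not_le_kappa order.trans by blast
    then have "x < x \<squnion> cover_label UNIV x y"
      by (simp add: less_le) (metis sup.cobounded2)
    moreover have "x \<squnion> cover_label UNIV x y \<le> y"
      using lab[OF cov] cov by (simp add: covered_by_def less_imp_le)
    ultimately show ?thesis using cov by (auto simp: covered_by_def le_less)
  qed
  have pop_down_eq: "pop_down x = x \<sqinter> \<Sqinter> (kappa UNIV ` down_labels UNIV x)"
    unfolding pop_down_def
  proof (rule order.antisym)
    \<comment> \<open>Each lower cover is below \<open>\<kappa>\<close> of its label. The converse
      inequality uses \<open>meet_cover\<close> for one lower cover at a time.\<close>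
    show "x \<sqinter> \<Sqinter> {y. covered_by UNIV y x} \<le> x \<sqinter> \<Sqinter> (kappa UNIV ` down_labels UNIV x)"
      by (auto simp: down_labels_def intro!: INF_greatest intro: le_infI2 Inf_lower2 lab)
    have "x \<sqinter> \<Sqinter> (kappa UNIV ` down_labels UNIV x) \<le> y" if "covered_by UNIV y x" for y
    proof -
      have "\<Sqinter> (kappa UNIV ` down_labels UNIV x) \<le> kappa UNIV (cover_label UNIV y x)"
        using that by (auto simp: down_labels_def intro: INF_lower)
      then show ?thesis using meet_cover[OF that] by (metis inf_mono order_refl)
    qed
    then show "x \<sqinter> \<Sqinter> (kappa UNIV ` down_labels UNIV x) \<le> x \<sqinter> \<Sqinter> {y. covered_by UNIV y x}"
      by (auto intro: Inf_greatest)
  qed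
  have pop_up_eq: "pop_up x = x \<squnion> \<Squnion> (up_labels UNIV x)"
    unfolding pop_up_def
  proof (rule order.antisym)
    show "x \<squnion> \<Squnion> (up_labels UNIV x) \<le> x \<squnion> \<Squnion> {y. covered_by UNIV x y}"
      by (auto simp: up_labels_def intro!: Sup_least intro: le_supI2 Sup_upper2 lab)
    have "y \<le> x \<squnion> \<Squnion> (up_labels UNIV x)" if "covered_by UNIV x y" for y
    proof -
      have "cover_label UNIV x y \<le> \<Squnion> (up_labels UNIV x)"
        using that by (auto simp: up_labels_def intro: Sup_upper)
      then show ?thesis using join_cover[OF that] by (metis sup_mono order_refl)
    qed
    then show "x \<squnion> \<Squnion> {y. covered_by UNIV x y} \<le> x \<squnion> \<Squnion> (up_labels UNIV x)"
      by (auto intro: Sup_least)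
  qed
  show ?thesis using row_eq row_inv_eq pop_down_eq pop_up_eq by simp
qed

end
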